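(* Let $n\equiv 2\pmod 6$ be a positive integer and $H$ an abelian group of order $n^2+n+1$. Suppose $T_0,T_1\subseteq H$ are inverse-closed subsets with $e\in T_0$ and $k_0+k_1=2n+1$ such that $T_0T_1=H-e$ and $T_0^2+T_1^2=2H-T_0^{(2)}-T_1^{(2)}+2ne$ in $\mathbb{Z}[H]$. Then, with $\ell_0=|T_1\cap T_0^{(3)}|$ and $u=|T_0\cap T_1^{(3)}|+|T_1\cap T_1^{(3)}|$, $$|X_0|\le\frac{n-2\ell_0-\theta_0}{3},\qquad\sum_{i\ge5}\frac{s_i}{3}|X_i|\le\frac{n-2\ell_0-\theta_0}{3},$$ $$|Y_0|\le\frac{n-2u+3-\theta_1}{3},\qquad\sum_{i\ge5}\frac{s_i}{3}|Y_i|\le\frac{n-2u+3-\theta_1}{3},$$ $$\frac{n^2-4n+7\ell_0+2\theta_0}{3}\le|X_4|\le\frac{n^2-n+\ell_0-\theta_0}{3},$$ $$\frac{2n^2-6n+7\ell_0+3+2\theta_0}{3}\le|X_1|\le\frac{2n^2-2n-\ell_0+3-2\theta_0}{3},$$ $$\frac{n^2-6n+7u-8+2\theta_1}{3}\le|Y_4|\le\frac{n^2-3n+u+1-\theta_1}{3},$$ $$\frac{2n^2-4n+7u-4+2\theta_1}{3}\le|Y_1|\le\frac{2n^2-u+8-2\theta_1}{3}.$$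
   Context: $H$ is written multiplicatively with identity $e$. $\mathbb{Z}[H]$ is the integral group ring; a (multi)subset $D$ of $H$ is identified with $\sum_{g\in D}g$, and $H$ also denotes $\sum_{h\in H}h$. For $A=\sum a_gg$ and $t\in\mathbb{Z}$, $A^{(t)}=\sum a_gg^t$. Inverse-closed means $T^{(-1)}=T$. $k_0=|T_0|$, $k_1=|T_1|$, $\hat T=T_0+T_1$. Intersections and set differences involving group ring elements with nonnegative coefficients refer to their supports. $X_i$ (resp. $Y_i$) is the set of elements of $H$ whose coefficient in $\hat T^{(2)}T_0$ (resp. $\hat T^{(2)}T_1$) is exactly $i$. $\theta_0=|(T_0^2\setminus T_0^{(2)})\cap\hat T^{(4)}|$ and $\theta_1=\frac{|T_1\cap\hat T^{(2)}|}{2}+|(T_1^2\setminus(T_1^{(2)}\cup\{e\}))\cap\hat T^{(4)}|$. For $i\ge5$, $s_i=\frac{(i-1)(i-4)}{2}$ if $i\equiv1\pmod3$ and $s_i=\frac{(i-2)(i-3)}{2}$ otherwise. *)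

theory Defs
  imports Complex_Main "HOL-Library.Poly_Mapping" "HOL-Library.Cardinality"
begin

text \<open>
  The integral group ring of \<open>H\<close> is the library's convolution ring \<^typ>\<open>'h \<Rightarrow>\<^sub>0 int\<close>, with \<open>H\<close> the
  type \<open>'h\<close>.  That ring takes its group in additive notation, so the product \<open>g h\<close> is \<open>g + h\<close>,
  the identity \<open>e\<close> is \<open>0\<close> and the power \<open>g\<^sup>t\<close> is \<open>zpower t g\<close>.  As ring elements, \<open>e\<close> is \<open>1\<close> and
  \<open>m e\<close> is \<open>of_nat m\<close>.  The support of \<open>A\<close> is \<^term>\<open>Poly_Mapping.keys A\<close>.
\<close>

definition zpower :: "int \<Rightarrow> 'h::ab_group_add \<Rightarrow> 'h" where
  "zpower t g = (if t \<ge> 0 then ((+) g ^^ nat t) 0 else - ((+) g ^^ nat (- t)) 0)"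

definition gsum :: "'h::{finite,ab_group_add} set \<Rightarrow> 'h \<Rightarrow>\<^sub>0 int" where
  "gsum D = (\<Sum>g\<in>D. Poly_Mapping.single g 1)"

text \<open>\<open>A\<^sup>(\<^sup>t\<^sup>)\<close>; coefficients add up if \<open>g \<mapsto> g\<^sup>t\<close> identifies elements.\<close>

definition gpow :: "int \<Rightarrow> ('h::ab_group_add \<Rightarrow>\<^sub>0 int) \<Rightarrow> ('h \<Rightarrow>\<^sub>0 int)" where
  "gpow t A = (\<Sum>g\<in>Poly_Mapping.keys A. Poly_Mapping.single (zpower t g) (Poly_Mapping.lookup A g))"

definition inverse_closed :: "'h::{finite,ab_group_add} set \<Rightarrow> bool" where
  "inverse_closed T \<longleftrightarrow> gpow (- 1) (gsum T) = gsum T"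

definition That :: "'h::{finite,ab_group_add} set \<Rightarrow> 'h set \<Rightarrow> ('h \<Rightarrow>\<^sub>0 int)" where
  "That T0 T1 = gsum T0 + gsum T1"

definition X_level :: "'h::{finite,ab_group_add} set \<Rightarrow> 'h set \<Rightarrow> nat \<Rightarrow> 'h set" where
  "X_level T0 T1 i = {h. Poly_Mapping.lookup (gpow 2 (That T0 T1) * gsum T0) h = int i}"

definition Y_level :: "'h::{finite,ab_group_add} set \<Rightarrow> 'h set \<Rightarrow> nat \<Rightarrow> 'h set" where
  "Y_level T0 T1 i = {h. Poly_Mapping.lookup (gpow 2 (That T0 T1) * gsum T1) h = int i}"

definition theta0 :: "'h::{finite,ab_group_add} set \<Rightarrow> 'h set \<Rightarrow> real" where
  "theta0 T0 T1 =
     real (card ((Poly_Mapping.keys (gsum T0 ^ 2) - Poly_Mapping.keys (gpow 2 (gsum T0)))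
       \<inter> Poly_Mapping.keys (gpow 4 (That T0 T1))))"

definition theta1 :: "'h::{finite,ab_group_add} set \<Rightarrow> 'h set \<Rightarrow> real" where
  "theta1 T0 T1 =
     real (card (T1 \<inter> Poly_Mapping.keys (gpow 2 (That T0 T1)))) / 2
     + real (card ((Poly_Mapping.keys (gsum T1 ^ 2) - (Poly_Mapping.keys (gpow 2 (gsum T1)) \<union> {0}))
         \<inter> Poly_Mapping.keys (gpow 4 (That T0 T1))))"

definition ell0 :: "'h::{finite,ab_group_add} set \<Rightarrow> 'h set \<Rightarrow> real" where
  "ell0 T0 T1 = real (card (T1 \<inter> Poly_Mapping.keys (gpow 3 (gsum T0))))"

definition u_num :: "'h::{finite,ab_group_add} set \<Rightarrow> 'h set \<Rightarrow> real" where
  "u_num T0 T1 = real (card (T0 \<inter> Poly_Mapping.keys (gpow 3 (gsum T1))))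
           + real (card (T1 \<inter> Poly_Mapping.keys (gpow 3 (gsum T1))))"

definition s_num :: "nat \<Rightarrow> real" where
  "s_num i = (if i mod 3 = 1 then (real i - 1) * (real i - 4) / 2
          else (real i - 2) * (real i - 3) / 2)"

text \<open>
  The sum over all \<open>i \<ge> 5\<close> of \<open>s\<^sub>i/3 \<bar>Z\<^sub>i\<bar>\<close> for a family of sets \<open>Z\<close>, written over the indices with
  \<open>Z\<^sub>i\<close> nonempty; these are finitely many for \<open>X_level\<close> and \<open>Y_level\<close>, as the following lemmas record.
\<close>

definition weighted_tail :: "(nat \<Rightarrow> 'h set) \<Rightarrow> real" where
  "weighted_tail Z = (\<Sum>i | i \<ge> 5 \<and> Z i \<noteq> {}. s_num i / 3 * real (card (Z i)))"

lemma finite_nonempty_levels: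
  fixes f :: "'h::finite \<Rightarrow> int"
  shows "finite {i::nat. {h. f h = int i} \<noteq> {}}"
proof (rule finite_subset)
  show "{i::nat. {h. f h = int i} \<noteq> {}} \<subseteq> range (\<lambda>h. nat (f h))"
  proof
    fix i assume "i \<in> {i::nat. {h. f h = int i} \<noteq> {}}"
    then obtain h where "f h = int i" by auto
    then have "i = nat (f h)" by simp
    then show "i \<in> range (\<lambda>h. nat (f h))" by simp
  qed
qed simp

lemma finite_X_levels: "finite {i. i \<ge> 5 \<and> X_level T0 T1 i \<noteq> {}}"
  unfolding X_level_def by (rule finite_subset [OF _ finite_nonempty_levels]) auto

lemma finite_Y_levels: "finite {i. i \<ge> 5 \<and> Y_level T0 T1 i \<noteq> {}}"
  unfolding Y_level_def by (rule finite_subset [OF _ finite_nonempty_levels]) auto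

end

theory Submission
  imports Defs
begin

text \<open>
  Let \<open>c\<close> be the coefficient function of \<open>That\<^sup>(\<^sup>2\<^sup>) T\<^sub>0\<close>.  The two group ring equations give
  \<open>That\<^sup>(\<^sup>2\<^sup>) T\<^sub>0 = m H + 2n T\<^sub>0 + T\<^sub>1 - T\<^sub>0\<^sup>3\<close> for an integer \<open>m\<close>, and \<open>T\<^sub>0\<^sup>3\<close> agrees with \<open>T\<^sub>0\<^sup>(\<^sup>3\<^sup>)\<close> modulo 3, so
  \<open>c\<close> is known modulo 3.  The sum of \<open>c\<close> is immediate, and the sum of \<open>c\<^sup>2\<close> is the coefficient of the
  identity in \<open>(That\<^sup>(\<^sup>2\<^sup>))\<^sup>2 T\<^sub>0\<^sup>2 = (4H + (2n-2)e - That\<^sup>(\<^sup>4\<^sup>)) T\<^sub>0\<^sup>2\<close>, where the coefficients of \<open>T\<^sub>0\<^sup>2\<close> off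
  the identity are 0, 1 or 2 and agree with those of \<open>T\<^sub>0\<^sup>(\<^sup>2\<^sup>)\<close> modulo 2.  The quadratic \<open>(i-1)(i-4)/2\<close>
  for \<open>i\<close> congruent to 1 modulo 3, and \<open>(i-2)(i-3)/2\<close> otherwise, is 3 at 0, vanishes at 1, 2, 3, 4 and is
  \<open>s\<^sub>i\<close> from 5 on; summing it over \<open>c\<close> yields an exact formula for \<open>3 |X\<^sub>0| + \<Sum>\<^sub>i s\<^sub>i |X\<^sub>i|\<close>, from which all
  bounds follow.  Everything is symmetric in \<open>T\<^sub>0\<close> and \<open>T\<^sub>1\<close> except for the position of the identity.
\<close>

subsection \<open>The integral group ring of a finite abelian group\<close>

lemma lookup_gsum: "Poly_Mapping.lookup (gsum D) h = of_bool (h \<in> D)"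
  unfolding gsum_def lookup_sum by (simp add: lookup_single when_def sum.delta)

lemma keys_gsum [simp]: "Poly_Mapping.keys (gsum D) = D"
  by (auto simp: in_keys_iff lookup_gsum)

lemma gsum_insert: "g \<notin> D \<Longrightarrow> gsum (insert g D) = Poly_Mapping.single g 1 + gsum D"
  by (simp add: gsum_def)

text \<open>The library sums over pairs of finite supports. In a finite group the second index is
  determined as \<open>x - a\<close>, and the sum over all of \<open>UNIV\<close> no longer depends
  on supports.\<close>

lemma lookup_times_finite:
  fixes A B :: "'h::{finite,ab_group_add} \<Rightarrow>\<^sub>0 'a::semiring_0"
  shows "Poly_Mapping.lookup (A * B) x
    = (\<Sum>a\<in>UNIV. Poly_Mapping.lookup A a * Poly_Mapping.lookup B (x - a))"
proof -
  have "(\<Sum>q. Poly_Mapping.lookup B q when x = a + q) = Poly_Mapping.lookup B (x - a)" for a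
  proof -
    have "(\<Sum>q. Poly_Mapping.lookup B q when x = a + q)
        = (\<Sum>q\<in>UNIV. Poly_Mapping.lookup B q when x = a + q)"
      by (rule Sum_any.expand_superset) auto
    also have "\<dots> = (\<Sum>q\<in>UNIV. if x - a = q then Poly_Mapping.lookup B q else 0)"
      by (rule sum.cong) (auto simp: when_def algebra_simps)
    finally show ?thesis by simp
  qed
  then show ?thesis
    unfolding lookup_mult by (simp add: Sum_any.expand_superset [of UNIV])
qed

lemma lookup_of_int_times:
  fixes A :: "'h::{finite,ab_group_add} \<Rightarrow>\<^sub>0 int"
  shows "Poly_Mapping.lookup (of_int c * A) x = c * Poly_Mapping.lookup A x"
proof -
  have "Poly_Mapping.lookup (of_int c * A) x
      = (\<Sum>a\<in>(UNIV::'h set). if a = 0 then c * Poly_Mapping.lookup A x else 0)"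
    unfolding lookup_times_finite by (rule sum.cong) (auto simp: lookup_of_int when_def)
  then show ?thesis by simp
qed

lemma lookup_numeral_times:
  fixes A :: "'h::{finite,ab_group_add} \<Rightarrow>\<^sub>0 int"
  shows "Poly_Mapping.lookup (numeral k * A) x = numeral k * Poly_Mapping.lookup A x"
  using lookup_of_int_times [of "numeral k" A x] by simp

lemma lookup_gsum_times_gsum:
  "Poly_Mapping.lookup (gsum A * gsum B) x = int (card {a \<in> A. x - a \<in> B})"
proof -
  have "Poly_Mapping.lookup (gsum A * gsum B) x
      = (\<Sum>a\<in>UNIV. of_bool (a \<in> A \<and> x - a \<in> B))"
    by (simp add: lookup_times_finite lookup_gsum of_bool_conj)
  then show ?thesis by (simp add: sum_of_bool_eq)
qed

lemma lookup_power2_gsum: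
  "Poly_Mapping.lookup (gsum A ^ 2) x = int (card {a \<in> A. x - a \<in> A})"
  by (simp add: power2_eq_square lookup_gsum_times_gsum)

section \<open>The augmentation homomorphism\<close>

definition aug :: "('h::{finite,ab_group_add} \<Rightarrow>\<^sub>0 int) \<Rightarrow> int" where
  "aug A = (\<Sum>h\<in>UNIV. Poly_Mapping.lookup A h)"

lemma aug_gsum: "aug (gsum D) = int (card D)"
  by (simp add: aug_def lookup_gsum sum_of_bool_eq)

lemma aug_times: "aug (A * B) = aug A * aug B"
proof -
  have shift: "(\<Sum>x\<in>UNIV. Poly_Mapping.lookup B (x - a)) = aug B" for a
    unfolding aug_def
    by (rule sum.reindex_bij_witness [of _ "\<lambda>x. x + a" "\<lambda>x. x - a"]) auto
  have "aug (A * B)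
      = (\<Sum>a\<in>UNIV. \<Sum>x\<in>UNIV. Poly_Mapping.lookup A a * Poly_Mapping.lookup B (x - a))"
    unfolding aug_def lookup_times_finite by (rule sum.swap)
  also have "\<dots> = (\<Sum>a\<in>UNIV. Poly_Mapping.lookup A a * aug B)"
    by (simp add: shift flip: sum_distrib_left)
  also have "\<dots> = aug A * aug B"
    by (simp add: aug_def sum_distrib_right)
  finally show ?thesis .
qed

text \<open>The whole group is invariant under translation, so every element of the support
  contributes its coefficient times \<open>gsum UNIV\<close>.\<close>

lemma gsum_UNIV_times: "gsum UNIV * A = of_int (aug A) * gsum UNIV"
proof (rule poly_mapping_eqI)
  fix x
  have "(\<Sum>a\<in>UNIV. Poly_Mapping.lookup A (x - a)) = aug A"
    unfolding aug_def
    by (rule sum.reindex_bij_witness [of _ "\<lambda>a. x - a" "\<lambda>a. x - a"]) auto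
  then show "Poly_Mapping.lookup (gsum UNIV * A) x
      = Poly_Mapping.lookup (of_int (aug A) * gsum UNIV) x"
    by (simp add: lookup_of_int_times) (simp add: lookup_times_finite lookup_gsum)
qed

section \<open>Power maps as endomorphisms of the group ring\<close>

lemma zpower_add: "zpower t (a + b) = zpower t a + zpower t b"
proof -
  have "((+) (a + b) ^^ k) 0 = ((+) a ^^ k) 0 + ((+) b ^^ k) 0" for k
    by (induction k) (auto simp: algebra_simps)
  then show ?thesis by (simp add: zpower_def)
qed

lemma zpower_0: "zpower t 0 = 0"
  using zpower_add [of t 0 0] by simp

lemma zpower_simps:
  "zpower (- 1) g = - g" "zpower 2 g = g + g" "zpower 3 g = g + (g + g)"
  "zpower 4 g = (g + g) + (g + g)"
  by (simp_all add: zpower_def numeral_eq_Suc add.assoc)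

text \<open>A summation range independent of \<open>A\<close> makes linearity of \<open>gpow\<close>
  immediate.\<close>

lemma gpow_finite:
  fixes A :: "'h::{finite,ab_group_add} \<Rightarrow>\<^sub>0 int"
  shows "gpow t A = (\<Sum>g\<in>UNIV. Poly_Mapping.single (zpower t g) (Poly_Mapping.lookup A g))"
  unfolding gpow_def by (rule sum.mono_neutral_left) (auto simp: in_keys_iff)

lemma gpow_add:
  fixes A B :: "'h::{finite,ab_group_add} \<Rightarrow>\<^sub>0 int"
  shows "gpow t (A + B) = gpow t A + gpow t B"
  by (simp add: gpow_finite lookup_add single_add sum.distrib)

lemma gpow_0 [simp]: "gpow t 0 = 0"
  by (simp add: gpow_def)

lemma gpow_single [simp]: "gpow t (Poly_Mapping.single g c) = Poly_Mapping.single (zpower t g) c"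
  by (simp add: gpow_def)

lemma gpow_sum:
  fixes f :: "'i \<Rightarrow> 'h::{finite,ab_group_add} \<Rightarrow>\<^sub>0 int"
  shows "gpow t (sum f I) = (\<Sum>i\<in>I. gpow t (f i))"
  by (induction I rule: infinite_finite_induct) (simp_all add: gpow_add)

lemma sum_singles:
  fixes A :: "'h::finite \<Rightarrow>\<^sub>0 int"
  shows "(\<Sum>g\<in>UNIV. Poly_Mapping.single g (Poly_Mapping.lookup A g)) = A"
  by (rule poly_mapping_eqI) (simp add: lookup_sum lookup_single when_def)

text \<open>In an abelian group \<open>zpower t\<close> is an endomorphism; multiplicativity on
  single group elements extends bilinearly after both factors are expanded.\<close>

lemma gpow_times:
  fixes A B :: "'h::{finite,ab_group_add} \<Rightarrow>\<^sub>0 int"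
  shows "gpow t (A * B) = gpow t A * gpow t B"
proof -
  have "gpow t (A * B) = gpow t ((\<Sum>g\<in>UNIV. Poly_Mapping.single g (Poly_Mapping.lookup A g))
      * (\<Sum>g\<in>UNIV. Poly_Mapping.single g (Poly_Mapping.lookup B g)))"
    by (simp add: sum_singles)
  also have "\<dots> = gpow t A * gpow t B"
    by (simp add: sum_product gpow_sum mult_single zpower_add gpow_finite [of t A]
        gpow_finite [of t B])
  finally show ?thesis .
qed

lemma gpow_gpow:
  fixes A :: "'h::{finite,ab_group_add} \<Rightarrow>\<^sub>0 int"
  assumes "\<And>g::'h. zpower s (zpower t g) = zpower r g"
  shows "gpow s (gpow t A) = gpow r A"
  by (simp add: gpow_finite [of t] gpow_finite [of r] gpow_sum assms)

text \<open>Without injectivity coefficients could pile up; with it the image of a set is again a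
  set.\<close>

lemma gpow_gsum:
  fixes D :: "'h::{finite,ab_group_add} set"
  assumes "inj (zpower t :: 'h \<Rightarrow> 'h)"
  shows "gpow t (gsum D) = gsum (zpower t ` D)"
proof -
  have "inj_on (zpower t) D" using assms inj_on_subset by blast
  then show ?thesis by (simp add: gsum_def gpow_sum sum.reindex)
qed

lemma lookup_gpow_minus_one:
  fixes A :: "'h::{finite,ab_group_add} \<Rightarrow>\<^sub>0 int"
  shows "Poly_Mapping.lookup (gpow (- 1) A) h = Poly_Mapping.lookup A (- h)"
proof -
  have "Poly_Mapping.lookup (gpow (- 1) A) h
      = (\<Sum>g\<in>UNIV. if g = - h then Poly_Mapping.lookup A g else 0)"
    unfolding gpow_finite lookup_sum
    by (rule sum.cong) (auto simp: lookup_single zpower_simps when_def)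
  then show ?thesis by simp
qed

text \<open>Squaring is additive modulo 2 in a commutative ring and is \<open>gpow 2\<close> on a
  single group element. Each inserted element adds its cross term to the witness.\<close>

lemma gsum_power2_cong: "\<exists>C. gsum D ^ 2 = gpow 2 (gsum D) + 2 * C"
proof (induction D rule: infinite_finite_induct)
  case (insert g D)
  then obtain C where C: "gsum D ^ 2 = gpow 2 (gsum D) + 2 * C" by auto
  have "gsum (insert g D) ^ 2
      = gpow 2 (gsum (insert g D)) + 2 * (C + Poly_Mapping.single g 1 * gsum D)"
    using insert C
    by (simp add: gsum_insert power2_sum gpow_add)
      (simp add: power2_eq_square mult_single zpower_simps algebra_simps)
  then show ?case by blast
qed (auto simp: gsum_def intro: exI [of _ 0])

text \<open>The same induction modulo 3, where the mixed terms of the cube carry the factor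
  3.\<close>

lemma gsum_power3_cong: "\<exists>C. gsum D ^ 3 = gpow 3 (gsum D) + 3 * C"
proof (induction D rule: infinite_finite_induct)
  case (insert g D)
  then obtain C where C: "gsum D ^ 3 = gpow 3 (gsum D) + 3 * C" by auto
  define s where "s = Poly_Mapping.single g (1::int)"
  have s: "s ^ 3 = gpow 3 s"
    by (simp add: s_def power3_eq_cube mult_single zpower_simps add.assoc)
  have "(s + gsum D) ^ 3 = s ^ 3 + gsum D ^ 3 + 3 * (s ^ 2 * gsum D + s * gsum D ^ 2)"
    by (simp add: power3_eq_cube power2_eq_square algebra_simps)
  then have "gsum (insert g D) ^ 3
      = gpow 3 (gsum (insert g D)) + 3 * (C + (s ^ 2 * gsum D + s * gsum D ^ 2))"
    using insert C s by (simp add: gsum_insert gpow_add algebra_simps flip: s_def)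
  then show ?case by blast
qed (auto simp: gsum_def intro: exI [of _ 0])

text \<open>Translation by \<open>x\<close> permutes the group, so the sum of all elements equals
  itself plus \<open>CARD('h)\<close> copies of \<open>x\<close>.\<close>

lemma funpow_add_CARD:
  fixes x :: "'h::{finite,ab_group_add}"
  shows "((+) x ^^ CARD('h)) 0 = 0"
proof -
  have nm: "(\<Sum>y\<in>A. x) = ((+) x ^^ card A) 0" for A :: "'h set"
    by (induction A rule: infinite_finite_induct) auto
  have "(\<Sum>y\<in>UNIV. y) = (\<Sum>y\<in>UNIV. x + y)"
    by (rule sum.reindex_bij_witness [of _ "\<lambda>y. x + y" "\<lambda>y. y - x"]) auto
  then have "(\<Sum>y\<in>(UNIV::'h set). x) = 0" by (simp add: sum.distrib)
  then show ?thesis by (simp add: nm)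
qed

text \<open>If \<open>k\<close> copies of \<open>x = a - b\<close> sum to 0, then so do
  \<open>k * m\<close> copies, and \<open>k * m + 1\<close> copies give \<open>x\<close>. That
  number is the group order, hence \<open>x = 0\<close>.\<close>

lemma inj_zpower:
  assumes "CARD('h::{finite,ab_group_add}) = k * m + 1"
  shows "inj (zpower (int k) :: 'h \<Rightarrow> 'h)"
proof (rule injI)
  fix a b :: 'h
  assume eq: "zpower (int k) a = zpower (int k) b"
  define x where "x = a - b"
  have "zpower (int k) a = zpower (int k) x + zpower (int k) b"
    by (simp add: x_def flip: zpower_add)
  with eq have "((+) x ^^ k) 0 = 0" by (simp add: zpower_def)
  moreover have "((+) x ^^ j) y = ((+) x ^^ j) 0 + y" for j y
    by (induction j) (auto simp: algebra_simps)
  ultimately have *: "((+) x ^^ k) y = y" for y by (metis add_0)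
  have "((+) x ^^ (k * i)) 0 = 0" for i
    by (induction i) (simp_all add: funpow_add *)
  then have "((+) x ^^ CARD('h)) 0 = x" unfolding assms by simp
  then show "a = b" using funpow_add_CARD [of x] by (simp add: x_def)
qed

lemma gpow_numeral: "gpow t (numeral k :: 'h::{finite,ab_group_add} \<Rightarrow>\<^sub>0 int) = numeral k"
  using gpow_single [of t "0::'h" "numeral k"] by (simp add: zpower_0)

lemma gpow_of_int: "gpow t (of_int k :: 'h::{finite,ab_group_add} \<Rightarrow>\<^sub>0 int) = of_int k"
proof -
  have "(of_int k :: 'h \<Rightarrow>\<^sub>0 int) = Poly_Mapping.single 0 k"
    by (metis single_of_int of_int_eq_id id_apply)
  then show ?thesis by (simp add: zpower_0)
qed

lemma gpow_diff:
  fixes A B :: "'h::{finite,ab_group_add} \<Rightarrow>\<^sub>0 int"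
  shows "gpow t (A - B) = gpow t A - gpow t B"
  using gpow_add [of t "A - B" B] by simp

text \<open>The coefficient of \<open>P ^ 2\<close> at 0 pairs \<open>a\<close> with
  \<open>- a\<close>; symmetry turns each product into a square.\<close>

lemma sum_lookup_power2_eq:
  fixes P :: "'h::{finite,ab_group_add} \<Rightarrow>\<^sub>0 int"
  assumes "\<And>h. Poly_Mapping.lookup P (- h) = Poly_Mapping.lookup P h"
  shows "(\<Sum>h\<in>UNIV. (Poly_Mapping.lookup P h)\<^sup>2) = Poly_Mapping.lookup (P ^ 2) 0"
  by (simp add: power2_eq_square lookup_times_finite assms)

subsection \<open>Level sets of an integer-valued function\<close>

text \<open>Regrouping by group element lets the tail be compared pointwise with other functions of
  \<open>c\<close>.\<close>

lemma weighted_tail_eq_sum: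
  fixes c :: "'h::finite \<Rightarrow> int"
  assumes nonneg: "\<And>h. c h \<ge> 0"
  shows "weighted_tail (\<lambda>i. {h. c h = int i})
    = (\<Sum>h\<in>UNIV. if c h \<ge> 5 then s_num (nat (c h)) / 3 else 0)"
proof -
  let ?I = "{i. i \<ge> 5 \<and> {h. c h = int i} \<noteq> {}}"
  have fin: "finite ?I"
    by (rule finite_subset [OF _ finite_nonempty_levels [of c]]) auto
  have "weighted_tail (\<lambda>i. {h. c h = int i})
      = (\<Sum>i\<in>?I. \<Sum>h | h \<in> {h. c h \<ge> 5} \<and> nat (c h) = i. s_num (nat (c h)) / 3)"
    unfolding weighted_tail_def
  proof (rule sum.cong)
    fix i assume "i \<in> ?I"
    then have "{h. h \<in> {h. c h \<ge> 5} \<and> nat (c h) = i} = {h. c h = int i}"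
      using nonneg by auto
    moreover have "(\<Sum>h | c h = int i. s_num (nat (c h)) / 3) = (\<Sum>h | c h = int i. s_num i / 3)"
      by (rule sum.cong) auto
    ultimately show "s_num i / 3 * real (card {h. c h = int i})
        = (\<Sum>h | h \<in> {h. c h \<ge> 5} \<and> nat (c h) = i. s_num (nat (c h)) / 3)"
      by (simp only:) simp
  qed simp
  also have "\<dots> = (\<Sum>h | c h \<ge> 5. s_num (nat (c h)) / 3)"
    by (rule sum.group) (use fin in \<open>auto simp: exI [of _ "nat (c _)"]\<close>)
  also have "\<dots> = (\<Sum>h\<in>UNIV. if c h \<ge> 5 then s_num (nat (c h)) / 3 else 0)"
    by (simp add: sum.If_cases)
  finally show ?thesis .
qed

text \<open>The subtracted number is the representative of \<open>x\<close> modulo 3 in {1, 2, 3}.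
  In each residue class the difference of the two sides is a quadratic in \<open>x\<close> that is
  nonnegative on the admissible values.\<close>

lemma s_num_lower:
  assumes "x \<ge> 5"
  shows "s_num x \<ge> real x - (if x mod 3 = 1 then 1 else if x mod 3 = 2 then 2 else 3)"
proof (cases "x mod 3 = 1")
  case True
  with assms have "x \<noteq> 5" "x \<noteq> 6" by auto
  with assms have "x \<ge> 7" by auto
  then have "(real x - 1) * (real x - 6) \<ge> 0" by (intro mult_nonneg_nonneg) auto
  then show ?thesis using True by (simp add: s_num_def field_simps)
next
  case False
  have "(real x - 5) * (real x - 2) \<ge> 0" using assms by (intro mult_nonneg_nonneg) auto
  moreover have "x mod 3 \<noteq> 2 \<Longrightarrow> x \<ge> 6" using assms by (cases "x = 5") auto
  then have "x mod 3 \<noteq> 2 \<Longrightarrow> (real x - 6) * (real x - 1) \<ge> 0"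
    by (intro mult_nonneg_nonneg) auto
  ultimately show ?thesis using False by (cases "x mod 3 = 2") (auto simp: s_num_def field_simps)
qed

text \<open>\<open>N\<close> counts the points with \<open>c h\<close> congruent to 1,
  \<open>K\<close> sums the excess of \<open>c h\<close> over its representative in {1, 2, 3}, and
  \<open>B\<close> sums the quadratic that detects level 0 and the tail. All bounds come from
  summing pointwise inequalities between these functions.\<close>

lemma level_bounds:
  fixes c :: "'h::finite \<Rightarrow> int" and U S :: "'h set" and B K N :: real
  defines "L \<equiv> \<lambda>i. {h. c h = int i}"
  assumes nonneg: "\<And>h. c h \<ge> 0"
    and cong: "\<And>h. c h mod 3 = (1 + of_bool (h \<in> U) - of_bool (h \<in> S)) mod 3"
    and B: "B = (real_of_int (\<Sum>h\<in>UNIV. (c h)\<^sup>2) - 5 * real_of_int (\<Sum>h\<in>UNIV. c h)) / 2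
      + 2 * real CARD('h) + real (card U) + real (card S) - 2 * real (card (U \<inter> S))"
    and K: "K = real_of_int (\<Sum>h\<in>UNIV. c h) - real CARD('h) - real (card U)
      - 2 * real (card S) + 3 * real (card (U \<inter> S))"
    and N: "N = real CARD('h) - real (card U) - real (card S) + 2 * real (card (U \<inter> S))"
  shows "0 \<le> B" "real (card (L 0)) \<le> B / 3" "weighted_tail L \<le> B / 3"
    and "(K - B) / 3 \<le> real (card (L 4))" "real (card (L 4)) \<le> (K + B) / 3"
    and "(3 * N - K - B) / 3 \<le> real (card (L 1))"
    and "real (card (L 1)) \<le> (3 * N - K + B) / 3"
proof -
  define z where "z j h = (of_bool (c h = j) :: real)" for j h
  define tl where "tl h = (if c h \<ge> 5 then s_num (nat (c h)) else 0)" for h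
  define p where "p h = (of_bool (h \<in> U) :: real)" for h
  define q where "q h = (of_bool (h \<in> S) :: real)" for h
  define r where "r h = (of_bool (h \<in> U \<inter> S) :: real)" for h
  define N1 where "N1 h = 1 - p h - q h + 2 * r h" for h
  define \<kappa> where "\<kappa> h = real_of_int (c h) - 1 - p h - 2 * q h + 3 * r h" for h
  \<comment> \<open>The residue is 1 exactly when \<open>h\<close> lies in both or neither of
    \<open>U\<close> and \<open>S\<close>, is 2 on \<open>U\<close> alone and 0 on \<open>S\<close>
    alone. The coefficients in \<open>N1\<close> and \<open>\<kappa>\<close> interpolate these four
    cases.\<close>
  have mod1: "N1 h = of_bool (c h mod 3 = 1)" for h
    using cong [of h] by (auto simp: N1_def p_def q_def r_def)
  have kap: "\<kappa> h = real_of_int (c h)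
      - (if c h mod 3 = 1 then 1 else if c h mod 3 = 2 then 2 else 3)" for h
    using cong [of h] by (auto simp: \<kappa>_def p_def q_def r_def)
  have small: "c h = 0 \<or> c h = 1 \<or> c h = 2 \<or> c h = 3 \<or> c h = 4 \<or> c h \<ge> 5" for h
    using nonneg [of h] by presburger
  have nat_mod: "(nat (c h) mod 3 = 1 \<longleftrightarrow> c h mod 3 = 1) \<and> (nat (c h) mod 3 = 2 \<longleftrightarrow> c h mod 3 = 2)"
    for h
  proof -
    obtain k where "c h = int k" using nonneg [of h] nonneg_int_cases by blast
    moreover have "(k mod 3 = 1 \<longleftrightarrow> int k mod 3 = 1) \<and> (k mod 3 = 2 \<longleftrightarrow> int k mod 3 = 2)"
      by presburger
    ultimately show ?thesis by (simp only: nat_int)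
  qed
  have tl_kap: "tl h \<ge> \<kappa> h" if "c h \<ge> 5" for h
    using s_num_lower [of "nat (c h)"] that
    unfolding nat_mod [THEN conjunct1] nat_mod [THEN conjunct2] by (simp add: tl_def kap nat_mod)
  have tl0: "tl h \<ge> 0" for h
  proof (cases "c h \<ge> 5")
    case True
    then have "\<kappa> h \<ge> 0" by (simp add: kap)
    with tl_kap [OF True] show ?thesis by simp
  qed (simp add: tl_def)
  \<comment> \<open>The quadratics for the two kinds of residue differ only in their constant, 2 for
    residue 1 and 3 otherwise, which is \<open>3 - N1 h\<close>.\<close>
  have e1: "3 * z 0 h + tl h
      = ((real_of_int (c h))\<^sup>2 - 5 * real_of_int (c h)) / 2 + 3 - N1 h" for h
    using small [of h] nat_mod [of h]
    by (auto simp: z_def tl_def mod1 s_num_def power2_eq_square field_simps)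
  \<comment> \<open>\<open>\<kappa>\<close> is -3 at level 0, zero at levels 1, 2, 3, equal to 3 at
    level 4 and at least 3 beyond. The corrections by \<open>z 0\<close> and \<open>tl\<close>
    absorb level 0 and the tail.\<close>
  have u4: "3 * z 4 h \<le> \<kappa> h + 3 * z 0 h" for h
    using small [of h] by (auto simp: z_def kap)
  have l4: "\<kappa> h - tl h \<le> 3 * z 4 h" for h
    using small [of h] tl_kap [of h] by (auto simp: z_def kap tl_def)
  have l1: "3 * N1 h - \<kappa> h - 3 * z 0 h \<le> 3 * z 1 h" for h
  proof -
    have "c h mod 3 = 1 \<Longrightarrow> c h \<ge> 5 \<Longrightarrow> c h \<ge> 7" by presburger
    then show ?thesis using small [of h] by (auto simp: z_def kap mod1)
  qed
  have u1: "3 * z 1 h \<le> 3 * N1 h - \<kappa> h + tl h" for h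
    using small [of h] tl_kap [of h] by (auto simp: z_def kap mod1 tl_def)
  have Z: "(\<Sum>h\<in>UNIV. z (int j) h) = real (card (L j))" for j
    by (simp add: z_def L_def sum_of_bool_eq)
  have tail: "(\<Sum>h\<in>UNIV. tl h) = 3 * weighted_tail L"
    unfolding L_def weighted_tail_eq_sum [OF nonneg] sum_distrib_left
    by (rule sum.cong) (auto simp: tl_def)
  have pqr: "(\<Sum>h\<in>UNIV. p h) = card U" "(\<Sum>h\<in>UNIV. q h) = card S"
    "(\<Sum>h\<in>UNIV. r h) = card (U \<inter> S)"
    by (simp_all add: p_def q_def r_def sum_of_bool_eq Int_def)
  have sN: "(\<Sum>h\<in>UNIV. N1 h) = N"
    by (simp add: N1_def sum.distrib sum_subtractf pqr N flip: sum_distrib_left)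
  have sK: "(\<Sum>h\<in>UNIV. \<kappa> h) = K"
    by (simp add: \<kappa>_def sum.distrib sum_subtractf pqr K flip: sum_distrib_left)
  have "3 * (\<Sum>h\<in>UNIV. z 0 h) + (\<Sum>h\<in>UNIV. tl h)
      = (\<Sum>h\<in>UNIV. ((real_of_int (c h))\<^sup>2 - 5 * real_of_int (c h)) / 2 + 3 - N1 h)"
    by (simp add: sum_distrib_left e1 flip: sum.distrib)
  also have "\<dots> = B"
    by (simp add: sum.distrib sum_subtractf sN N B flip: sum_divide_distrib sum_distrib_left)
  finally have B': "3 * real (card (L 0)) + 3 * weighted_tail L = B"
    using Z [of 0] tail by simp
  have t0: "weighted_tail L \<ge> 0"
    using sum_nonneg [of UNIV tl] tl0 tail by simp
  show "0 \<le> B" "real (card (L 0)) \<le> B / 3" "weighted_tail L \<le> B / 3"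
    using B' t0 by auto
  have "3 * (\<Sum>h\<in>UNIV. z 4 h) \<le> (\<Sum>h\<in>UNIV. \<kappa> h) + 3 * (\<Sum>h\<in>UNIV. z 0 h)"
    unfolding sum_distrib_left sum.distrib [symmetric] by (intro sum_mono u4)
  then show "real (card (L 4)) \<le> (K + B) / 3" using Z [of 4] Z [of 0] sK B' t0 by simp
  have "(\<Sum>h\<in>UNIV. \<kappa> h) - (\<Sum>h\<in>UNIV. tl h) \<le> 3 * (\<Sum>h\<in>UNIV. z 4 h)"
    unfolding sum_distrib_left sum_subtractf [symmetric] by (intro sum_mono l4)
  then show "(K - B) / 3 \<le> real (card (L 4))" using Z [of 4] tail sK B' by simp
  have "3 * (\<Sum>h\<in>UNIV. N1 h) - (\<Sum>h\<in>UNIV. \<kappa> h) - 3 * (\<Sum>h\<in>UNIV. z 0 h)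
      \<le> 3 * (\<Sum>h\<in>UNIV. z 1 h)"
    unfolding sum_distrib_left sum_subtractf [symmetric] by (intro sum_mono l1)
  then show "(3 * N - K - B) / 3 \<le> real (card (L 1))"
    using Z [of 1] Z [of 0] sK sN B' t0 by simp
  have "3 * (\<Sum>h\<in>UNIV. z 1 h)
      \<le> 3 * (\<Sum>h\<in>UNIV. N1 h) - (\<Sum>h\<in>UNIV. \<kappa> h) + (\<Sum>h\<in>UNIV. tl h)"
    unfolding sum_distrib_left sum_subtractf [symmetric] sum.distrib [symmetric]
    by (intro sum_mono u1)
  then show "real (card (L 1)) \<le> (3 * N - K + B) / 3"
    using Z [of 1] tail sK sN B' by simp
qed


subsection \<open>Pairs of sets satisfying the two equations\<close>

text \<open>The identity is only required to lie in the union, so that the assumptions are symmetric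
  and every result also holds with \<open>A\<close> and \<open>B\<close> exchanged.\<close>

locale tiling_pair =
  fixes n :: nat and A B :: "'h::{finite,ab_group_add} set"
  assumes n_mod: "n mod 6 = 2"
    and card_H: "CARD('h) = n ^ 2 + n + 1"
    and inv_A: "inverse_closed A" and inv_B: "inverse_closed B"
    and zero_mem: "0 \<in> A \<union> B"
    and card_sum: "card A + card B = 2 * n + 1"
    and prod_eq: "gsum A * gsum B = gsum UNIV - 1"
    and squares_eq: "gsum A ^ 2 + gsum B ^ 2
      = 2 * gsum UNIV - gpow 2 (gsum A) - gpow 2 (gsum B) + of_nat (2 * n)"
begin

lemma swap: "tiling_pair n B A"
  using n_mod card_H inv_A inv_B zero_mem card_sum prod_eq squares_eq
  by unfold_locales (auto simp: algebra_simps)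

abbreviation dbl :: "'h set \<Rightarrow> 'h set" where "dbl D \<equiv> zpower 2 ` D"

abbreviation tpl :: "'h set \<Rightarrow> 'h set" where "tpl D \<equiv> zpower 3 ` D"

section \<open>Injective power maps on a group of order 1 modulo 6\<close>

lemma CARD_eq_6: "\<exists>m. CARD('h) = 6 * m + 1"
proof -
  obtain q where q: "n = 6 * q + 2" using n_mod by (metis mult_div_mod_eq)
  have "CARD('h) = 6 * (6 * q ^ 2 + 5 * q + 1) + 1"
    unfolding card_H q by (simp add: power2_eq_square algebra_simps)
  then show ?thesis by blast
qed

lemma inj_2: "inj (zpower 2 :: 'h \<Rightarrow> 'h)"
proof -
  obtain m where "CARD('h) = 6 * m + 1" using CARD_eq_6 by blast
  then have "CARD('h) = 2 * (3 * m) + 1" by simp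
  from inj_zpower [OF this] show ?thesis by simp
qed

lemma inj_3: "inj (zpower 3 :: 'h \<Rightarrow> 'h)"
proof -
  obtain m where "CARD('h) = 6 * m + 1" using CARD_eq_6 by blast
  then have "CARD('h) = 3 * (2 * m) + 1" by simp
  from inj_zpower [OF this] show ?thesis by simp
qed

lemma zpower4_eq: "zpower 4 (g::'h) = zpower 2 (zpower 2 g)"
  by (simp add: zpower_simps)

lemma inj_4: "inj (zpower 4 :: 'h \<Rightarrow> 'h)"
  using inj_compose [OF inj_2 inj_2] by (simp add: comp_def flip: zpower4_eq)

lemma double_eq_0: "x + x = 0 \<longleftrightarrow> x = 0" for x :: 'h
  using inj_2 [THEN injD, of x 0] by (auto simp: zpower_simps)

lemma uminus_mem_A: "- h \<in> A \<longleftrightarrow> h \<in> A"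
  using inv_A lookup_gpow_minus_one [of "gsum A" h]
  by (simp add: inverse_closed_def lookup_gsum of_bool_def split: if_splits)

lemma uminus_mem_B: "- h \<in> B \<longleftrightarrow> h \<in> B"
  using inv_B lookup_gpow_minus_one [of "gsum B" h]
  by (simp add: inverse_closed_def lookup_gsum of_bool_def split: if_splits)

text \<open>A common element \<open>a\<close> would give the representation \<open>a + (- a)\<close>
  of 0, but the identity has coefficient 0 in \<open>gsum A * gsum B\<close>.\<close>

lemma disjoint: "A \<inter> B = {}"
proof -
  have "int (card {a \<in> A. 0 - a \<in> B}) = 0"
    using arg_cong [OF prod_eq, of "\<lambda>P. Poly_Mapping.lookup P 0"]
    unfolding lookup_gsum_times_gsum by (simp add: lookup_minus lookup_gsum)
  then show ?thesis by (auto simp: uminus_mem_B)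
qed

lemma That_eq: "That A B = gsum (A \<union> B)"
  unfolding That_def gsum_def using disjoint by (simp add: sum.union_disjoint)

lemma card_Un: "card (A \<union> B) = 2 * n + 1"
  using card_sum disjoint by (simp add: card_Un_disjoint)

section \<open>Coefficients of the squares of the two sets\<close>

abbreviation coA :: "'h \<Rightarrow> int" where "coA \<equiv> Poly_Mapping.lookup (gsum A ^ 2)"

abbreviation coB :: "'h \<Rightarrow> int" where "coB \<equiv> Poly_Mapping.lookup (gsum B ^ 2)"

lemma coA_add_coB:
  assumes "h \<noteq> 0"
  shows "coA h + coB h + of_bool (h \<in> dbl A) + of_bool (h \<in> dbl B) = 2"
  using arg_cong [OF squares_eq, of "\<lambda>P. Poly_Mapping.lookup P h"] assms
  by (simp add: lookup_add lookup_minus lookup_numeral_times gpow_gsum inj_2 lookup_gsum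
      lookup_of_nat lookup_numeral_times del: of_nat_mult)

lemma coA_parity: "coA h mod 2 = of_bool (h \<in> dbl A)"
proof -
  obtain C where "gsum A ^ 2 = gpow 2 (gsum A) + 2 * C"
    using gsum_power2_cong by blast
  then have "coA h = of_bool (h \<in> dbl A) + 2 * Poly_Mapping.lookup C h"
    by (simp add: lookup_add lookup_numeral_times gpow_gsum inj_2 lookup_gsum)
  then show ?thesis by simp
qed

lemma coA_nonneg: "coA h \<ge> 0"
  by (simp add: lookup_power2_gsum)

lemma coA_0: "coA 0 = int (card A)"
  by (simp add: lookup_power2_gsum uminus_mem_A)

text \<open>Off the identity \<open>coA_add_coB\<close> bounds the coefficient by 2, and by 1 on
  \<open>dbl A\<close>; parity then leaves 1 on \<open>dbl A\<close> and 0 or 2 elsewhere.\<close>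

lemma coA_eq:
  assumes "h \<noteq> 0"
  shows "coA h = of_bool (h \<in> dbl A) + 2 * of_bool (coA h \<noteq> 0 \<and> h \<notin> dbl A)"
proof -
  have "coB h \<ge> 0" by (simp add: lookup_power2_gsum)
  then have "coA h \<le> 2" "h \<in> dbl A \<Longrightarrow> coA h \<le> 1"
    using coA_add_coB [OF assms] by (simp_all add: of_bool_def split: if_splits)
  moreover have "coA h = 0 \<or> coA h = 1 \<or> coA h = 2"
    using coA_nonneg [of h] calculation(1) by presburger
  ultimately show ?thesis using coA_parity [of h] by auto
qed

text \<open>If \<open>g = h\<^sup>3\<close> with \<open>g\<close> and \<open>h\<close> in \<open>A\<close>, then \<open>h\<^sup>2 = h h = g h\<^sup>-\<^sup>1\<close> has too many representations.\<close>

lemma Int_tpl_subset: "A \<inter> tpl A \<subseteq> {0}"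
proof
  fix g assume "g \<in> A \<inter> tpl A"
  then obtain h where g: "g \<in> A" and h: "h \<in> A" and gh: "g = h + (h + h)"
    by (auto simp: zpower_simps)
  show "g \<in> {0}"
  proof (rule ccontr)
    assume "g \<notin> {0}"
    then have h0: "h \<noteq> 0" using gh by auto
    have "{h, g} \<subseteq> {a \<in> A. zpower 2 h - a \<in> A}"
      using g h uminus_mem_A [of h] by (auto simp: gh zpower_simps)
    then have "card {h, g} \<le> card {a \<in> A. zpower 2 h - a \<in> A}"
      by (intro card_mono) auto
    moreover have "h \<noteq> g" using h0 by (simp add: gh double_eq_0)
    ultimately have "coA (zpower 2 h) \<ge> 2" by (simp add: lookup_power2_gsum)
    moreover have "zpower 2 h \<noteq> 0" using h0 by (simp add: zpower_simps double_eq_0)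
    ultimately show False using coA_eq [of "zpower 2 h"] h by simp
  qed
qed

text \<open>A nonzero \<open>g\<close> in \<open>A\<close> has the representations
  \<open>0 + g\<close> and \<open>g + 0\<close>, which already exhaust the total 2 in
  \<open>coA_add_coB\<close>.\<close>

lemma Int_dbl_subset:
  assumes "0 \<in> A"
  shows "A \<inter> dbl (A \<union> B) \<subseteq> {0}"
proof
  fix g assume "g \<in> A \<inter> dbl (A \<union> B)"
  then have g: "g \<in> A" and g2: "g \<in> dbl A \<or> g \<in> dbl B" by auto
  show "g \<in> {0}"
  proof (rule ccontr)
    assume "g \<notin> {0}"
    then have g0: "g \<noteq> 0" by simp
    have "card {0, g} \<le> card {a \<in> A. g - a \<in> A}"
      using g assms by (intro card_mono) auto
    then have a2: "coA g \<ge> 2" using g0 by (simp add: lookup_power2_gsum)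
    moreover have "coB g \<ge> 0" by (simp add: lookup_power2_gsum)
    ultimately show False using coA_add_coB [OF g0] g2 by (simp add: of_bool_def split: if_splits)
  qed
qed

text \<open>Sum and product of the two cardinalities force them to be \<open>n\<close> and
  \<open>n + 1\<close>; parity decides which is which. The coefficient of \<open>gsum A ^ 2\<close>
  at 0 is \<open>card A\<close>, odd because 0 lies in \<open>dbl A\<close>, while \<open>n\<close>
  is even.\<close>

lemma card_A:
  assumes "0 \<in> A"
  shows "card A = n + 1"
proof -
  have "0 \<in> dbl A" using assms by (force simp: zpower_simps)
  then have "odd (card A)"
    using coA_parity [of 0] by (simp add: coA_0) presburger
  have "aug (gsum (UNIV::'h set) - 1) = (\<Sum>h\<in>(UNIV::'h set). 1 - of_bool (h = 0))"
    unfolding aug_def by (rule sum.cong) (auto simp: lookup_minus lookup_gsum lookup_one when_def)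
  also have "\<dots> = int CARD('h) - 1"
    by (simp add: sum_subtractf sum_of_bool_eq)
  finally have "int (card A) * int (card B) = int CARD('h) - 1"
    by (simp only: aug_times aug_gsum flip: prod_eq)
  then have prod: "int (card A) * int (card B) = int n * (int n + 1)"
    by (simp add: card_H power2_eq_square algebra_simps)
  have B: "int (card B) = 2 * int n + 1 - int (card A)" using card_sum by simp
  have "(int (card A) - int n) * (int (card A) - (int n + 1)) = 0"
    using prod unfolding B by (simp add: algebra_simps)
  then have "card A = n \<or> card A = n + 1" unfolding mult_eq_0_iff by linarith
  moreover have "even n" using n_mod by presburger
  ultimately show ?thesis using \<open>odd (card A)\<close> by auto
qed

section \<open>The square of \<open>That A B\<close> and its image under doubling\<close>

lemma That_power2: "That A B ^ 2 = 4 * gsum UNIV + of_int (2 * int n - 2) - gpow 2 (That A B)"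
proof -
  have "That A B ^ 2 = (gsum A ^ 2 + gsum B ^ 2) + 2 * (gsum A * gsum B)"
    by (simp add: That_def power2_sum)
  then show ?thesis
    unfolding squares_eq prod_eq by (simp add: That_def gpow_add algebra_simps)
qed

lemma gpow2_gsum_UNIV: "gpow 2 (gsum (UNIV :: 'h set)) = gsum UNIV"
proof -
  have "surj (zpower 2 :: 'h \<Rightarrow> 'h)" by (rule finite_UNIV_inj_surj) (simp_all add: inj_2)
  then show ?thesis by (simp add: gpow_gsum inj_2)
qed

text \<open>Apply the ring endomorphism \<open>gpow 2\<close> to \<open>That_power2\<close>; it
  fixes \<open>gsum UNIV\<close> and the multiples of the identity.\<close>

lemma gpow2_That_power2:
  "gpow 2 (That A B) ^ 2 = 4 * gsum UNIV + of_int (2 * int n - 2) - gpow 4 (That A B)"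
proof -
  have "gpow 2 (That A B) ^ 2 = gpow 2 (That A B ^ 2)"
    by (simp add: power2_eq_square gpow_times)
  also have "\<dots> = 4 * gsum UNIV + of_int (2 * int n - 2) - gpow 2 (gpow 2 (That A B))"
    unfolding That_power2
    by (simp only: gpow_diff gpow_add gpow_times gpow_numeral gpow_of_int gpow2_gsum_UNIV)
  also have "gpow 2 (gpow 2 (That A B)) = gpow 4 (That A B)"
    by (rule gpow_gpow) (simp add: zpower4_eq)
  finally show ?thesis .
qed

section \<open>The product \<open>P\<close>: residues modulo 3, sum and sum of squares\<close>

definition P :: "'h \<Rightarrow>\<^sub>0 int" where
  "P = gpow 2 (That A B) * gsum A"

text \<open>Eliminate \<open>gpow 2 (That A B)\<close> by \<open>squares_eq\<close>, then reduce the
  term in \<open>gsum B ^ 2 * gsum A\<close> by \<open>prod_eq\<close>. The multiple of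
  \<open>gsum UNIV\<close> is \<open>2 * card A - card B\<close>.\<close>

lemma P_eq: "P = of_int (3 * int (card A) - 2 * int n - 1) * gsum UNIV
    + of_nat (2 * n) * gsum A + gsum B - gsum A ^ 3"
proof -
  have H: "gsum UNIV * gsum D = of_int (int (card D)) * gsum UNIV" for D :: "'h set"
    by (simp add: gsum_UNIV_times aug_gsum)
  have "gpow 2 (That A B)
      = 2 * gsum UNIV + of_nat (2 * n) - gsum A ^ 2 - gsum B ^ 2"
    using squares_eq by (simp add: That_def gpow_add algebra_simps)
  then have "P = (2 * gsum UNIV + of_nat (2 * n) - gsum A ^ 2 - gsum B ^ 2) * gsum A"
    by (simp add: P_def)
  also have "\<dots> = 2 * (gsum UNIV * gsum A) + of_nat (2 * n) * gsum A - gsum A ^ 3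
      - gsum B * (gsum A * gsum B)"
    by (simp add: algebra_simps power2_eq_square power3_eq_cube)
  also have "gsum B * (gsum A * gsum B) = gsum UNIV * gsum B - gsum B"
    unfolding prod_eq by (simp add: algebra_simps)
  also have "gsum UNIV * gsum B = of_int (2 * int n + 1 - int (card A)) * gsum UNIV"
    unfolding H using card_sum by (intro arg_cong [where f = "\<lambda>k. of_int k * gsum UNIV"]) simp
  finally show ?thesis
    by (simp only: H) (simp add: algebra_simps)
qed

text \<open>As \<open>n\<close> is 2 modulo 3, both \<open>- 2 * n - 1\<close> and
  \<open>2 * n\<close> are 1 modulo 3, and the cube of \<open>gsum A\<close> may be replaced by
  \<open>gpow 3 (gsum A)\<close>.\<close>

lemma lookup_P_mod_3: "Poly_Mapping.lookup P h mod 3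
    = (1 + of_bool (h \<in> A \<union> B) - of_bool (h \<in> tpl A)) mod 3"
proof -
  obtain C where C: "gsum A ^ 3 = gpow 3 (gsum A) + 3 * C"
    using gsum_power3_cong by blast
  have "int n mod 3 = 2" using n_mod by presburger
  then obtain q where q: "int n = 3 * q + 2" by (metis mult_div_mod_eq)
  have "Poly_Mapping.lookup P h = (3 * int (card A) - 2 * int n - 1)
      + 2 * int n * of_bool (h \<in> A) + of_bool (h \<in> B)
      - of_bool (h \<in> tpl A) - 3 * Poly_Mapping.lookup C h"
    using lookup_of_int_times [of "int (2 * n)" "gsum A" h]
    unfolding P_eq C
    by (simp only: lookup_add lookup_minus lookup_of_int_times lookup_numeral_times
        gpow_gsum [OF inj_3] lookup_gsum of_int_of_nat_eq) simp
  also have "\<dots> = (1 + of_bool (h \<in> A) + of_bool (h \<in> B) - of_bool (h \<in> tpl A))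
      + 3 * (int (card A) - 2 * q - 2 + (2 * q + 1) * of_bool (h \<in> A) - Poly_Mapping.lookup C h)"
    by (simp add: q algebra_simps)
  finally have "Poly_Mapping.lookup P h mod 3
      = (1 + of_bool (h \<in> A) + of_bool (h \<in> B) - of_bool (h \<in> tpl A)) mod 3"
    by (simp only: mod_mult_self2)
  moreover have "of_bool (h \<in> A \<union> B) = (of_bool (h \<in> A) + of_bool (h \<in> B) :: int)"
    using disjoint by auto
  ultimately show ?thesis by (simp only: add.assoc)
qed

lemma gpow2_That: "gpow 2 (That A B) = gsum (dbl (A \<union> B))"
  by (simp add: That_eq gpow_gsum inj_2)

lemma gpow4_That: "gpow 4 (That A B) = gsum (zpower 4 ` (A \<union> B))"
  by (simp add: That_eq gpow_gsum inj_4)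

lemma lookup_P_nonneg: "Poly_Mapping.lookup P h \<ge> 0"
  by (simp add: P_def gpow2_That lookup_gsum_times_gsum)

lemma sum_lookup_P: "(\<Sum>h\<in>UNIV. Poly_Mapping.lookup P h) = (2 * int n + 1) * int (card A)"
proof -
  have "card (dbl (A \<union> B)) = 2 * n + 1"
    using inj_2 card_Un by (metis card_image inj_on_subset subset_UNIV)
  then have "aug P = (2 * int n + 1) * int (card A)"
    by (simp add: P_def gpow2_That aug_times aug_gsum)
  then show ?thesis by (simp add: aug_def)
qed

lemma lookup_P_uminus: "Poly_Mapping.lookup P (- h) = Poly_Mapping.lookup P h"
proof -
  have "gpow (- 1) (gpow 2 (That A B)) = gpow (- 2) (That A B)"
    by (rule gpow_gpow) (simp add: zpower_def numeral_eq_Suc)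
  also have "\<dots> = gpow 2 (gpow (- 1) (That A B))"
    by (rule gpow_gpow [symmetric]) (simp add: zpower_def numeral_eq_Suc)
  also have "gpow (- 1) (That A B) = That A B"
    using inv_A inv_B by (simp add: That_def gpow_add inverse_closed_def)
  finally have "gpow (- 1) P = P"
    using inv_A by (simp add: P_def gpow_times inverse_closed_def)
  then show ?thesis using lookup_gpow_minus_one [of P h] by simp
qed

text \<open>
  For \<open>A = T\<^sub>0\<close> removing the identity is redundant, as it lies in \<open>T\<^sub>0\<^sup>(\<^sup>2\<^sup>)\<close>; it makes one formula serve
  for both \<open>theta0\<close> and \<open>theta1\<close>.
\<close>

definition Theta :: "'h set" where
  "Theta = (Poly_Mapping.keys (gsum A ^ 2) - (Poly_Mapping.keys (gpow 2 (gsum A)) \<union> {0}))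
     \<inter> Poly_Mapping.keys (gpow 4 (That A B))"

text \<open>By symmetry this is the sum of \<open>coA\<close> over the quadrupled union:
  \<open>card A\<close> at the identity, then 1 on \<open>dbl A\<close> and 2 on
  \<open>Theta\<close>.\<close>

lemma lookup_gpow4_times:
  "Poly_Mapping.lookup (gpow 4 (That A B) * gsum A ^ 2) 0
    = int (card A) + int (card (A \<inter> dbl (A \<union> B) - {0})) + 2 * int (card Theta)"
proof -
  let ?F = "zpower 4 ` (A \<union> B)"
  have "zpower 4 (0::'h) = 0" by (simp add: zpower_simps)
  then have zero: "0 \<in> ?F" using zero_mem by (metis image_eqI)
  have co: "coA h = of_bool (h \<in> dbl A) + 2 * of_bool (h \<in> Poly_Mapping.keys (gsum A ^ 2) - dbl A)"
    if "h \<noteq> 0" for h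
    using coA_eq [OF that] by (simp add: in_keys_iff)
  have sym: "coA (- h) = coA h" for h
  proof -
    have "gpow (- 1) (gsum A ^ 2) = gsum A ^ 2"
      using inv_A by (simp add: power2_eq_square gpow_times inverse_closed_def)
    then show ?thesis using lookup_gpow_minus_one [of "gsum A ^ 2" h] by simp
  qed
  have "Poly_Mapping.lookup (gpow 4 (That A B) * gsum A ^ 2) 0
      = (\<Sum>h\<in>UNIV. of_bool (h \<in> ?F) * coA h)"
    by (simp add: lookup_times_finite gpow4_That lookup_gsum sym)
  also have "\<dots> = (\<Sum>h\<in>?F. coA h)"
    by (rule sum.mono_neutral_cong_right) auto
  also have "\<dots> = int (card A) + (\<Sum>h\<in>?F - {0}. coA h)"
    using zero by (simp add: sum.remove coA_0)
  also have "(\<Sum>h\<in>?F - {0}. coA h) = (\<Sum>h\<in>?F - {0}. of_bool (h \<in> dbl A))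
      + 2 * (\<Sum>h\<in>?F - {0}. of_bool (h \<in> Poly_Mapping.keys (gsum A ^ 2) - dbl A))"
    unfolding sum_distrib_left sum.distrib [symmetric]
    by (rule sum.cong) (use co in auto)
  also have "(\<Sum>h\<in>?F - {0}. of_bool (h \<in> dbl A)) = int (card ((?F - {0}) \<inter> dbl A))"
    by (simp add: sum_of_bool_eq)
  \<comment> \<open>Quadrupling is doubling twice, so one doubling can be cancelled from both sets;
    the count becomes one inside \<open>A\<close>.\<close>
  also have "(?F - {0}) \<inter> dbl A = dbl (A \<inter> dbl (A \<union> B) - {0})"
  proof -
    have F: "?F = dbl (dbl (A \<union> B))" by (simp add: image_image zpower4_eq)
    have z: "{0::'h} = dbl {0}" by (simp add: zpower_simps)
    show ?thesis unfolding F
      by (subst z) (simp only: image_Int [OF inj_2] image_set_diff [OF inj_2] Int_commute, blast)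
  qed
  also have "card \<dots> = card (A \<inter> dbl (A \<union> B) - {0})"
    using inj_2 by (metis card_image inj_on_subset subset_UNIV)
  also have "(\<Sum>h\<in>?F - {0}. of_bool (h \<in> Poly_Mapping.keys (gsum A ^ 2) - dbl A))
      = int (card ((?F - {0}) \<inter> (Poly_Mapping.keys (gsum A ^ 2) - dbl A)))"
    by (simp add: sum_of_bool_eq set_diff_eq)
  also have "(?F - {0}) \<inter> (Poly_Mapping.keys (gsum A ^ 2) - dbl A) = Theta"
    by (auto simp: Theta_def gpow4_That gpow_gsum inj_2)
  finally show ?thesis by simp
qed

lemma sum_lookup_P_power2: "(\<Sum>h\<in>UNIV. (Poly_Mapping.lookup P h)\<^sup>2)
    = 4 * (int (card A))\<^sup>2 + (2 * int n - 3) * int (card A)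
      - int (card (A \<inter> dbl (A \<union> B) - {0})) - 2 * int (card Theta)"
proof -
  have "P ^ 2 = gpow 2 (That A B) ^ 2 * gsum A ^ 2"
    by (simp add: P_def power_mult_distrib)
  also have "\<dots> = 4 * (gsum UNIV * gsum A ^ 2) + of_int (2 * int n - 2) * gsum A ^ 2
      - gpow 4 (That A B) * gsum A ^ 2"
    unfolding gpow2_That_power2 by (simp only: left_diff_distrib distrib_right mult.assoc)
  also have "gsum UNIV * gsum A ^ 2 = of_int ((int (card A))\<^sup>2) * gsum UNIV"
    by (simp add: gsum_UNIV_times power2_eq_square aug_times aug_gsum)
  finally have "Poly_Mapping.lookup (P ^ 2) 0
      = 4 * (int (card A))\<^sup>2 + (2 * int n - 2) * int (card A)
        - Poly_Mapping.lookup (gpow 4 (That A B) * gsum A ^ 2) 0"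
    by (simp only: lookup_add lookup_minus lookup_of_int_times lookup_numeral_times coA_0)
      (simp add: lookup_gsum)
  then show ?thesis
    unfolding lookup_gpow4_times sum_lookup_power2_eq [of P, OF lookup_P_uminus]
    by (simp add: algebra_simps)
qed

lemma X_level_eq: "X_level A B = (\<lambda>i. {h. Poly_Mapping.lookup P h = int i})"
  by (simp add: X_level_def P_def fun_eq_iff)

lemma card_tpl: "card (tpl A) = card A"
  using inj_3 by (metis card_image inj_on_subset subset_UNIV)

text \<open>Instance of \<open>level_bounds\<close> with \<open>U = A \<union> B\<close> and
  \<open>S = tpl A\<close>, kept in terms of \<open>card A\<close> to serve both sets of the pair.
  Halving the sum of squares produces the factor 1/2 seen in \<open>theta1\<close>.\<close>

lemma X_level_bounds:
  fixes \<beta> \<kappa> \<nu> :: real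
  assumes \<beta>: "\<beta> = 2 * real (card A) ^ 2 - (4 * real n + 3) * real (card A) + 2 * real n ^ 2 + 4 * real n + 3
      - 2 * real (card ((A \<union> B) \<inter> tpl A))
      - (real (card (A \<inter> dbl (A \<union> B) - {0})) / 2 + real (card Theta))"
    and \<kappa>: "\<kappa> = (2 * real n - 1) * real (card A) - real n ^ 2 - 3 * real n - 2
      + 3 * real (card ((A \<union> B) \<inter> tpl A))"
    and \<nu>: "\<nu> = real n ^ 2 - real n - real (card A) + 2 * real (card ((A \<union> B) \<inter> tpl A))"
  shows "0 \<le> \<beta>" "real (card (X_level A B 0)) \<le> \<beta> / 3" "weighted_tail (X_level A B) \<le> \<beta> / 3"
    and "(\<kappa> - \<beta>) / 3 \<le> real (card (X_level A B 4))" "real (card (X_level A B 4)) \<le> (\<kappa> + \<beta>) / 3"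
    and "(3 * \<nu> - \<kappa> - \<beta>) / 3 \<le> real (card (X_level A B 1))"
    and "real (card (X_level A B 1)) \<le> (3 * \<nu> - \<kappa> + \<beta>) / 3"
  unfolding X_level_eq
  by (rule level_bounds [OF lookup_P_nonneg lookup_P_mod_3];
      simp only: sum_lookup_P sum_lookup_P_power2 card_Un card_H card_tpl \<beta> \<kappa> \<nu>;
      simp add: field_simps power2_eq_square)+

end

text \<open>Reduces the bounds on the Y levels to \<open>X_level_bounds\<close> for the swapped
  pair.\<close>

lemma Y_level_eq_X_level: "Y_level T0 T1 = X_level T1 T0"
  by (simp add: Y_level_def X_level_def That_def add.commute fun_eq_iff)

theorem theorem4p4:
  fixes n :: nat and T0 T1 :: "'h::{finite,ab_group_add} set"
  assumes "n > 0" and "n mod 6 = 2"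
    and "CARD('h) = n ^ 2 + n + 1"
    and "inverse_closed T0" and "inverse_closed T1"
    and "0 \<in> T0"
    and "card T0 + card T1 = 2 * n + 1"
    and "gsum T0 * gsum T1 = gsum UNIV - 1"
    and "gsum T0 ^ 2 + gsum T1 ^ 2
         = 2 * gsum UNIV - gpow 2 (gsum T0) - gpow 2 (gsum T1) + of_nat (2 * n)"
  shows
   "real (card (X_level T0 T1 0)) \<le> (real n - 2 * ell0 T0 T1 - theta0 T0 T1) / 3 \<and>
    weighted_tail (X_level T0 T1) \<le> (real n - 2 * ell0 T0 T1 - theta0 T0 T1) / 3 \<and>
    real (card (Y_level T0 T1 0)) \<le> (real n - 2 * u_num T0 T1 + 3 - theta1 T0 T1) / 3 \<and>
    weighted_tail (Y_level T0 T1) \<le> (real n - 2 * u_num T0 T1 + 3 - theta1 T0 T1) / 3 \<and>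
    (real n ^ 2 - 4 * real n + 7 * ell0 T0 T1 + 2 * theta0 T0 T1) / 3 \<le> real (card (X_level T0 T1 4)) \<and>
    real (card (X_level T0 T1 4)) \<le> (real n ^ 2 - real n + ell0 T0 T1 - theta0 T0 T1) / 3 \<and>
    (2 * real n ^ 2 - 6 * real n + 7 * ell0 T0 T1 + 3 + 2 * theta0 T0 T1) / 3 \<le> real (card (X_level T0 T1 1)) \<and>
    real (card (X_level T0 T1 1)) \<le> (2 * real n ^ 2 - 2 * real n - ell0 T0 T1 + 3 - 2 * theta0 T0 T1) / 3 \<and>
    (real n ^ 2 - 6 * real n + 7 * u_num T0 T1 - 8 + 2 * theta1 T0 T1) / 3 \<le> real (card (Y_level T0 T1 4)) \<and>
    real (card (Y_level T0 T1 4)) \<le> (real n ^ 2 - 3 * real n + u_num T0 T1 + 1 - theta1 T0 T1) / 3 \<and>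
    (2 * real n ^ 2 - 4 * real n + 7 * u_num T0 T1 - 4 + 2 * theta1 T0 T1) / 3 \<le> real (card (Y_level T0 T1 1)) \<and>
    real (card (Y_level T0 T1 1)) \<le> (2 * real n ^ 2 - u_num T0 T1 + 8 - 2 * theta1 T0 T1) / 3"
proof -
  interpret X: tiling_pair n T0 T1
    using assms by unfold_locales auto
  interpret Y: tiling_pair n T1 T0
    by (rule X.swap)
  have k0: "card T0 = n + 1" using X.card_A assms(6) by simp
  then have k1: "card T1 = n" using assms(7) by simp
  have That_swap: "That T1 T0 = That T0 T1" by (simp add: That_def add.commute)
  have not_mem: "0 \<notin> T1" using X.disjoint assms(6) by auto
  have dbl0: "0 \<in> X.dbl T0" using assms(6) by (force simp: zpower_simps)
  have tpl0: "0 \<in> X.tpl T0" using assms(6) by (force simp: zpower_simps)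
  have dbl0': "0 \<in> X.dbl (T0 \<union> T1)" using dbl0 by blast

  \<comment> \<open>The identity is the only element of \<open>T0\<close> in its own triple; it
    accounts for the 1 added to \<open>ell0\<close>.\<close>
  have "(T0 \<union> T1) \<inter> X.tpl T0 = insert 0 (T1 \<inter> X.tpl T0)"
    using X.Int_tpl_subset tpl0 assms(6) by auto
  then have wX: "real (card ((T0 \<union> T1) \<inter> X.tpl T0)) = 1 + ell0 T0 T1"
    using not_mem by (simp add: ell0_def gpow_gsum X.inj_3)
  \<comment> \<open>Hence \<open>theta0\<close> has no counterpart of the halved term of
    \<open>theta1\<close>.\<close>
  have "T0 \<inter> X.dbl (T0 \<union> T1) - {0} = {}"
    using X.Int_dbl_subset assms(6) by auto
  then have mX: "card (T0 \<inter> X.dbl (T0 \<union> T1) - {0}) = 0" by simp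
  have "Poly_Mapping.keys (gpow 2 (gsum T0)) \<union> {0} = Poly_Mapping.keys (gpow 2 (gsum T0))"
    using dbl0 by (auto simp: gpow_gsum X.inj_2)
  then have thX: "real (card X.Theta) = theta0 T0 T1"
    by (simp only: X.Theta_def theta0_def)

  have "(T1 \<union> T0) \<inter> X.tpl T1 = (T0 \<inter> X.tpl T1) \<union> (T1 \<inter> X.tpl T1)" by auto
  moreover have "card \<dots> = card (T0 \<inter> X.tpl T1) + card (T1 \<inter> X.tpl T1)"
    using X.disjoint by (intro card_Un_disjoint) auto
  ultimately have wY: "real (card ((T1 \<union> T0) \<inter> X.tpl T1)) = u_num T0 T1"
    by (simp add: u_num_def gpow_gsum X.inj_3)
  have "T1 \<inter> X.dbl (T1 \<union> T0) - {0} = T1 \<inter> Poly_Mapping.keys (gpow 2 (That T0 T1))"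
    using not_mem by (auto simp: X.gpow2_That)
  then have thY: "real (card (T1 \<inter> X.dbl (T1 \<union> T0) - {0})) / 2 + real (card Y.Theta)
      = theta1 T0 T1"
    by (simp only: Y.Theta_def theta1_def That_swap)

  \<comment> \<open>Values of the three parameters of \<open>X_level_bounds\<close> at
    \<open>card T0 = n + 1\<close> and at \<open>card T1 = n\<close>.\<close>
  define BX where "BX = real n - 2 * ell0 T0 T1 - theta0 T0 T1"
  define KX where "KX = real n ^ 2 - 2 * real n + 3 * ell0 T0 T1"
  define NX where "NX = real n ^ 2 - 2 * real n + 1 + 2 * ell0 T0 T1"
  define BY where "BY = real n + 3 - 2 * u_num T0 T1 - theta1 T0 T1"
  define KY where "KY = real n ^ 2 - 4 * real n - 2 + 3 * u_num T0 T1"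
  define NY where "NY = real n ^ 2 - 2 * real n + 2 * u_num T0 T1"
  have X: "BX = 2 * real (card T0) ^ 2 - (4 * real n + 3) * real (card T0) + 2 * real n ^ 2
        + 4 * real n + 3 - 2 * real (card ((T0 \<union> T1) \<inter> X.tpl T0))
        - (real (card (T0 \<inter> X.dbl (T0 \<union> T1) - {0})) / 2 + real (card X.Theta))"
    "KX = (2 * real n - 1) * real (card T0) - real n ^ 2 - 3 * real n - 2
        + 3 * real (card ((T0 \<union> T1) \<inter> X.tpl T0))"
    "NX = real n ^ 2 - real n - real (card T0) + 2 * real (card ((T0 \<union> T1) \<inter> X.tpl T0))"
    unfolding wX mX thX k0 BX_def KX_def NX_def by (simp_all add: power2_eq_square algebra_simps)
  have Y: "BY = 2 * real (card T1) ^ 2 - (4 * real n + 3) * real (card T1) + 2 * real n ^ 2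
        + 4 * real n + 3 - 2 * real (card ((T1 \<union> T0) \<inter> X.tpl T1))
        - (real (card (T1 \<inter> X.dbl (T1 \<union> T0) - {0})) / 2 + real (card Y.Theta))"
    "KY = (2 * real n - 1) * real (card T1) - real n ^ 2 - 3 * real n - 2
        + 3 * real (card ((T1 \<union> T0) \<inter> X.tpl T1))"
    "NY = real n ^ 2 - real n - real (card T1) + 2 * real (card ((T1 \<union> T0) \<inter> X.tpl T1))"
    unfolding wY thY k1 BY_def KY_def NY_def by (simp_all add: power2_eq_square algebra_simps)
  \<comment> \<open>The lower bounds at level 4 and both bounds at level 1 are claimed with error
    \<open>2 * BX\<close> or \<open>2 * BY\<close> where \<open>X_level_bounds\<close> gives a
    single one; \<open>0 \<le> BX\<close> and \<open>0 \<le> BY\<close> close the gap.\<close>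
  show ?thesis
    using X.X_level_bounds [OF X] Y.X_level_bounds [OF Y]
    unfolding Y_level_eq_X_level BX_def KX_def NX_def BY_def KY_def NY_def
    by (intro conjI) argo+
qed

end
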